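(* Let $1\le k<n$ be integers and let $\mathbf{k}$ be a field. For all integers $j$ with $k<j\leq n$ and all integers $l$ with ${j-1\choose k}<l\leq{j \choose k}$, we have $$I_{k,n,l}=I_{j,n}=\Big\langle \prod_{s\in\sigma} x_s:\ \sigma \subseteq \{1,\dots,n\},\ \vert\sigma\vert=j\Big\rangle .$$
   Context: Let $R=\mathbf{k}[x_1,\dots,x_n]$ be the polynomial ring over the field $\mathbf{k}$. For $1\le j\le n$, $I_{j,n}\subseteq R$ denotes the failure ideal of the $j$-out-of-$n$:F system (the system with $n$ components that fails whenever $j$ of them fail), i.e. the monomial ideal $I_{j,n}=\langle \prod_{s\in\sigma} x_s:\ \sigma \subseteq \{1,\dots,n\},\ \vert\sigma\vert=j\rangle$. For a monomial ideal $I\subseteq R$ with minimal monomial generating set $\{m_1,\dots,m_r\}$ and $1\le i\le r$, the $i$-fold lcm-ideal of $I$ is the ideal generated by the least common multiples of all sets of $i$ distinct minimal monomial generators of $I$: $I_i=\langle \mathrm{lcm}(\{m_t\}_{t\in\sigma}) : \sigma\subseteq\{1,\dots,r\},\ \vert\sigma\vert=i\rangle$. $I_{k,n,i}$ denotes the $i$-fold lcm-ideal of $I_{k,n}$ (here $r={n\choose k}$). *)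

theory Defs
  imports "HOL-Library.Poly_Mapping" "HOL-Algebra.Ideal"
begin

text \<open>
  A monomial in the variables \<open>x\<^sub>s\<close> is represented by its exponent vector, of type
  \<open>nat \<Rightarrow>\<^sub>0 nat\<close>; the type \<open>(nat \<Rightarrow>\<^sub>0 nat) \<Rightarrow>\<^sub>0 'k\<close> is then the polynomial ring in countably many
  variables, with convolution as multiplication, and \<open>k[x\<^sub>1, \<dots>, x\<^sub>n]\<close> is the subring of the
  polynomials that only involve variables with index in \<open>{1..n}\<close>.
\<close>

type_synonym 'k mpoly = "(nat \<Rightarrow>\<^sub>0 nat) \<Rightarrow>\<^sub>0 'k"

definition monomial :: "(nat \<Rightarrow>\<^sub>0 nat) \<Rightarrow> 'k::field mpoly" where
  "monomial m = Poly_Mapping.single m 1"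

definition var :: "nat \<Rightarrow> 'k::field mpoly" where
  "var s = monomial (Poly_Mapping.single s 1)"

definition mpoly_ring :: "nat \<Rightarrow> 'k::field mpoly ring" where
  "mpoly_ring n =
    \<lparr>carrier = {p. \<forall>m\<in>Poly_Mapping.keys p. Poly_Mapping.keys m \<subseteq> {1..n}},
     mult = (*), one = 1, zero = 0, add = (+)\<rparr>"

lemma cring_mpoly_ring: "cring (mpoly_ring n :: 'k::field mpoly ring)"
proof (rule cringI)
  show "abelian_group (mpoly_ring n :: 'k mpoly ring)"
  proof (rule abelian_groupI)
    fix x y :: "'k mpoly"
    assume "x \<in> carrier (mpoly_ring n)" "y \<in> carrier (mpoly_ring n)"
    then show "x \<oplus>\<^bsub>mpoly_ring n\<^esub> y \<in> carrier (mpoly_ring n)"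
      using Poly_Mapping.keys_add[of x y] by (fastforce simp: mpoly_ring_def)
  next
    fix x :: "'k mpoly"
    assume "x \<in> carrier (mpoly_ring n)"
    then show "\<exists>y\<in>carrier (mpoly_ring n). y \<oplus>\<^bsub>mpoly_ring n\<^esub> x = \<zero>\<^bsub>mpoly_ring n\<^esub>"
      by (intro bexI[of _ "- x"]) (auto simp: mpoly_ring_def)
  qed (auto simp: mpoly_ring_def algebra_simps)
  show "comm_monoid (mpoly_ring n :: 'k mpoly ring)"
  proof (rule comm_monoidI)
    fix x y :: "'k mpoly"
    assume xy: "x \<in> carrier (mpoly_ring n)" "y \<in> carrier (mpoly_ring n)"
    have "Poly_Mapping.keys m \<subseteq> {1..n}" if m: "m \<in> Poly_Mapping.keys (x * y)" for m
    proof -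
      obtain a b where "m = a + b" "a \<in> Poly_Mapping.keys x" "b \<in> Poly_Mapping.keys y"
        using m Poly_Mapping.keys_mult[of x y] by blast
      then show ?thesis
        using xy Poly_Mapping.keys_add[of a b] by (fastforce simp: mpoly_ring_def)
    qed
    then show "x \<otimes>\<^bsub>mpoly_ring n\<^esub> y \<in> carrier (mpoly_ring n)"
      by (auto simp: mpoly_ring_def)
  qed (auto simp: mpoly_ring_def algebra_simps)
qed (auto simp: mpoly_ring_def algebra_simps)

text \<open>Least common multiple of a finite nonempty set of monomials: the componentwise maximum
  of the exponent vectors.\<close>

definition monomial_lcm :: "(nat \<Rightarrow>\<^sub>0 nat) set \<Rightarrow> (nat \<Rightarrow>\<^sub>0 nat)" where
  "monomial_lcm A =
    (\<Sum>s\<in>(\<Union>m\<in>A. Poly_Mapping.keys m).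
      Poly_Mapping.single s (Max ((\<lambda>m. Poly_Mapping.lookup m s) ` A)))"

lemma lookup_monomial_lcm:
  assumes "finite A" "A \<noteq> {}"
  shows "Poly_Mapping.lookup (monomial_lcm A) s = Max ((\<lambda>m. Poly_Mapping.lookup m s) ` A)"
proof (cases "s \<in> (\<Union>m\<in>A. Poly_Mapping.keys m)")
  case True
  then show ?thesis
    using assms by (simp add: monomial_lcm_def lookup_sum lookup_single when_def)
next
  case False
  then have "(\<lambda>m. Poly_Mapping.lookup m s) ` A = {0}"
    using assms(2) by (auto simp: in_keys_iff image_iff)
  moreover have "Poly_Mapping.lookup (monomial_lcm A) s = 0"
    unfolding monomial_lcm_def lookup_sum using False
    by (intro sum.neutral) (auto simp: lookup_single when_def)
  ultimately show ?thesis by simp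
qed

definition min_monomial_gens ::
    "nat \<Rightarrow> 'k::field mpoly set \<Rightarrow> (nat \<Rightarrow>\<^sub>0 nat) set \<Rightarrow> bool" where
  "min_monomial_gens n I M \<longleftrightarrow>
    (\<forall>m\<in>M. Poly_Mapping.keys m \<subseteq> {1..n}) \<and>
    Idl\<^bsub>mpoly_ring n\<^esub> (monomial ` M) = I \<and>
    (\<forall>M'. M' \<subset> M \<longrightarrow> Idl\<^bsub>mpoly_ring n\<^esub> (monomial ` M') \<noteq> I)"

text \<open>The minimal monomial generating set of a monomial ideal is unique, so the definite
  description below denotes it.\<close>

definition lcm_ideal :: "nat \<Rightarrow> nat \<Rightarrow> 'k::field mpoly set \<Rightarrow> 'k mpoly set" where
  "lcm_ideal n i I =
    Idl\<^bsub>mpoly_ring n\<^esub> {monomial (monomial_lcm \<sigma>) | \<sigma>.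
      \<sigma> \<subseteq> (THE M. min_monomial_gens n I M) \<and> card \<sigma> = i}"

definition failure_ideal :: "nat \<Rightarrow> nat \<Rightarrow> 'k::field mpoly set" where
  "failure_ideal j n =
    Idl\<^bsub>mpoly_ring n\<^esub> {\<Prod>s\<in>\<sigma>. var s | \<sigma>. \<sigma> \<subseteq> {1..n} \<and> card \<sigma> = j}"

end

theory Submission
  imports Defs
begin

text \<open>
  Everything is read off from exponent vectors: a monomial lies in an ideal generated by monomials
  iff it is divisible by a generator, so the squarefree monomials of degree \<open>k\<close>, being an
  antichain for divisibility, are the minimal generators of \<open>I\<^bsub>k,n\<^esub>\<close>.
  The lcm of a family of them is the squarefree monomial on the union \<open>U\<close> of the supports.
  If \<open>l > (j-1) choose k\<close> sets of size \<open>k\<close> are involved, then \<open>|U| \<ge> j\<close>, so the lcm lies in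
  \<open>I\<^bsub>j,n\<^esub>\<close>; conversely, a set of size \<open>j\<close> has at least \<open>l\<close> subsets of size \<open>k\<close>, so its monomial is
  divisible by an \<open>l\<close>-fold lcm.
\<close>

section \<open>Monomial ideals: membership and minimal generators\<close>

lemma carrier_mpoly_ring:
  "p \<in> carrier (mpoly_ring n) \<longleftrightarrow> (\<forall>m\<in>Poly_Mapping.keys p. Poly_Mapping.keys m \<subseteq> {1..n})"
  by (simp add: mpoly_ring_def)

lemma keys_monomial [simp]: "Poly_Mapping.keys (monomial m :: 'k::field mpoly) = {m}"
  by (simp add: monomial_def)

lemma monomial_mult: "monomial a * monomial b = (monomial (a + b) :: 'k::field mpoly)"
  by (simp add: monomial_def mult_single)

text \<open>Upper bound for the ideal generated by \<open>M\<close>, described by supports;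
  pointwise \<open>\<le>\<close> of lookups is divisibility. Absorption holds because each key of a
  product is \<open>u + v\<close> with \<open>v\<close> a key of the second factor, and a divisor of
  \<open>v\<close> divides \<open>u + v\<close>.\<close>

lemma ideal_mpoly_ring_divisible_keys:
  "ideal {p \<in> carrier (mpoly_ring n). \<forall>m\<in>Poly_Mapping.keys p.
      \<exists>a\<in>M. Poly_Mapping.lookup a \<le> Poly_Mapping.lookup m} (mpoly_ring n :: 'k::field mpoly ring)"
  (is "ideal ?J ?R")
proof -
  interpret cring ?R by (rule cring_mpoly_ring)
  have mult_closed: "x \<otimes>\<^bsub>?R\<^esub> a \<in> ?J" if a: "a \<in> ?J" and x: "x \<in> carrier ?R" for a x
  proof -
    have "\<exists>c\<in>M. Poly_Mapping.lookup c \<le> Poly_Mapping.lookup m"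
      if m: "m \<in> Poly_Mapping.keys (x * a)" for m
    proof -
      obtain u v where uv: "m = u + v" "v \<in> Poly_Mapping.keys a"
        using m Poly_Mapping.keys_mult[of x a] by blast
      with a obtain c where "c \<in> M" "Poly_Mapping.lookup c \<le> Poly_Mapping.lookup v"
        by blast
      then show ?thesis
        using uv(1) by (auto simp: le_fun_def lookup_add intro!: bexI[of _ c] trans_le_add2)
    qed
    moreover have "x \<otimes>\<^bsub>?R\<^esub> a \<in> carrier ?R"
      using a x by blast
    ultimately show ?thesis
      by (simp add: mpoly_ring_def)
  qed
  have "subgroup ?J (add_monoid ?R)"
  proof (rule add.subgroupI)
    have "\<zero>\<^bsub>?R\<^esub> \<in> ?J"
      by (simp add: mpoly_ring_def)
    then show "?J \<noteq> {}"
      by blast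
    \<comment> \<open>Negation is multiplication by minus one, so absorption applies.\<close>
    show "\<ominus>\<^bsub>?R\<^esub> a \<in> ?J" if "a \<in> ?J" for a
      using mult_closed[of a "\<ominus>\<^bsub>?R\<^esub> \<one>\<^bsub>?R\<^esub>"] that by (simp add: l_minus)
    show "a \<oplus>\<^bsub>?R\<^esub> b \<in> ?J" if "a \<in> ?J" "b \<in> ?J" for a b
    proof -
      have "a \<oplus>\<^bsub>?R\<^esub> b \<in> carrier ?R"
        using that by blast
      then show ?thesis
        using that Poly_Mapping.keys_add[of a b] by (auto simp: mpoly_ring_def)
    qed
  qed auto
  then show ?thesis
    using mult_closed by (intro idealI) (auto simp: m_comm local.ring_axioms)
qed

text \<open>Forward: the ideal of the previous lemma contains the generators, hence all they
  generate, and \<open>m\<close> is the only key of \<open>monomial m\<close>. Backward: multiply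
  the dividing generator by its cofactor.\<close>

lemma monomial_mem_Idl_iff:
  assumes M: "\<forall>a\<in>M. Poly_Mapping.keys a \<subseteq> {1..n}" and m: "Poly_Mapping.keys m \<subseteq> {1..n}"
  shows "(monomial m :: 'k::field mpoly) \<in> Idl\<^bsub>mpoly_ring n\<^esub> (monomial ` M) \<longleftrightarrow>
    (\<exists>a\<in>M. Poly_Mapping.lookup a \<le> Poly_Mapping.lookup m)"
proof -
  interpret cring "mpoly_ring n :: 'k mpoly ring" by (rule cring_mpoly_ring)
  let ?J = "{p \<in> carrier (mpoly_ring n :: 'k mpoly ring). \<forall>m\<in>Poly_Mapping.keys p.
      \<exists>a\<in>M. Poly_Mapping.lookup a \<le> Poly_Mapping.lookup m}"
  have gens: "monomial ` M \<subseteq> carrier (mpoly_ring n :: 'k mpoly ring)"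
    using M by (auto simp: carrier_mpoly_ring)
  show ?thesis
  proof
    assume mem: "(monomial m :: 'k mpoly) \<in> Idl\<^bsub>mpoly_ring n\<^esub> (monomial ` M)"
    have "Idl\<^bsub>mpoly_ring n\<^esub> (monomial ` M) \<subseteq> ?J"
      using gens by (intro genideal_minimal ideal_mpoly_ring_divisible_keys) auto
    with mem show "\<exists>a\<in>M. Poly_Mapping.lookup a \<le> Poly_Mapping.lookup m"
      by auto
  next
    assume "\<exists>a\<in>M. Poly_Mapping.lookup a \<le> Poly_Mapping.lookup m"
    then obtain a where a: "a \<in> M" "Poly_Mapping.lookup a \<le> Poly_Mapping.lookup m"
      by blast
    \<comment> \<open>Subtraction of exponents is truncated; divisibility makes it exact
      here.\<close>
    have "m = a + (m - a)"
      using a(2) by (intro poly_mapping_eqI) (simp add: le_fun_def lookup_add lookup_minus)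
    then have m_eq: "(monomial m :: 'k mpoly) = monomial a * monomial (m - a)"
      by (simp add: monomial_mult)
    have "Poly_Mapping.keys (m - a) \<subseteq> Poly_Mapping.keys m"
      by (auto simp: in_keys_iff lookup_minus)
    then have "(monomial (m - a) :: 'k mpoly) \<in> carrier (mpoly_ring n)"
      using m by (simp add: carrier_mpoly_ring)
    moreover have "(monomial a :: 'k mpoly) \<in> Idl\<^bsub>mpoly_ring n\<^esub> (monomial ` M)"
      using genideal_self[OF gens] a(1) by blast
    ultimately have "monomial a \<otimes>\<^bsub>mpoly_ring n\<^esub> monomial (m - a)
        \<in> Idl\<^bsub>mpoly_ring n\<^esub> (monomial ` M :: 'k mpoly set)"
      using ideal.I_r_closed[OF genideal_ideal[OF gens]] by blast
    then show "(monomial m :: 'k mpoly) \<in> Idl\<^bsub>mpoly_ring n\<^esub> (monomial ` M)"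
      by (simp add: m_eq mpoly_ring_def)
  qed
qed

text \<open>Applied in both directions, this reduces equality of monomial ideals to divisibility
  between generators.\<close>

lemma Idl_monomial_mono:
  assumes A: "\<forall>a\<in>A. Poly_Mapping.keys a \<subseteq> {1..n}" and B: "\<forall>b\<in>B. Poly_Mapping.keys b \<subseteq> {1..n}"
    and "\<forall>a\<in>A. \<exists>b\<in>B. Poly_Mapping.lookup b \<le> Poly_Mapping.lookup a"
  shows "Idl\<^bsub>mpoly_ring n\<^esub> (monomial ` A :: 'k::field mpoly set) \<subseteq> Idl\<^bsub>mpoly_ring n\<^esub> (monomial ` B)"
proof -
  interpret cring "mpoly_ring n :: 'k mpoly ring" by (rule cring_mpoly_ring)
  have "monomial ` B \<subseteq> carrier (mpoly_ring n :: 'k mpoly ring)"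
    using B by (auto simp: carrier_mpoly_ring)
  moreover have "monomial ` A \<subseteq> Idl\<^bsub>mpoly_ring n\<^esub> (monomial ` B :: 'k mpoly set)"
    using A assms(3) monomial_mem_Idl_iff[OF B] by blast
  ultimately show ?thesis
    by (intro genideal_minimal genideal_ideal)
qed

text \<open>Stated as an equivalence to give existence and uniqueness at once, which is what
  evaluating the \<open>THE\<close> in \<open>lcm_ideal\<close> requires.\<close>

lemma min_monomial_gens_antichain_iff:
  assumes M: "\<forall>a\<in>M. Poly_Mapping.keys a \<subseteq> {1..n}"
    and antichain: "\<And>a b. a \<in> M \<Longrightarrow> b \<in> M \<Longrightarrow>
      Poly_Mapping.lookup a \<le> Poly_Mapping.lookup b \<Longrightarrow> a = b"
  shows "min_monomial_gens n (Idl\<^bsub>mpoly_ring n\<^esub> (monomial ` M) :: 'k::field mpoly set) N \<longleftrightarrow> N = M"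
proof
  have self: "(monomial a :: 'k mpoly) \<in> Idl\<^bsub>mpoly_ring n\<^esub> (monomial ` N)"
    if "a \<in> N" "\<forall>a\<in>N. Poly_Mapping.keys a \<subseteq> {1..n}" for a N
    using that by (subst monomial_mem_Idl_iff) auto
  {
    assume N: "min_monomial_gens n (Idl\<^bsub>mpoly_ring n\<^esub> (monomial ` M) :: 'k mpoly set) N"
    then have keys_N: "\<forall>a\<in>N. Poly_Mapping.keys a \<subseteq> {1..n}"
      and Idl_N: "Idl\<^bsub>mpoly_ring n\<^esub> (monomial ` N) = (Idl\<^bsub>mpoly_ring n\<^esub> (monomial ` M) :: 'k mpoly set)"
      and minimal: "\<And>N'. N' \<subset> N \<Longrightarrow>
        Idl\<^bsub>mpoly_ring n\<^esub> (monomial ` N') \<noteq> (Idl\<^bsub>mpoly_ring n\<^esub> (monomial ` M) :: 'k mpoly set)"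
      by (auto simp: min_monomial_gens_def)
    \<comment> \<open>Some \<open>a\<close> in \<open>N\<close> divides \<open>m\<close>, and some
      \<open>b\<close> in \<open>M\<close> divides \<open>a\<close>. The antichain property gives
      \<open>b = m\<close>, so \<open>a = m\<close> by antisymmetry.\<close>
    have "M \<subseteq> N"
    proof
      fix m assume m: "m \<in> M"
      then have "(monomial m :: 'k mpoly) \<in> Idl\<^bsub>mpoly_ring n\<^esub> (monomial ` N)"
        using self M Idl_N by simp
      then obtain a where a: "a \<in> N" "Poly_Mapping.lookup a \<le> Poly_Mapping.lookup m"
        using monomial_mem_Idl_iff[OF keys_N] m M by blast
      then have "(monomial a :: 'k mpoly) \<in> Idl\<^bsub>mpoly_ring n\<^esub> (monomial ` M)"
        using self keys_N Idl_N by blast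
      then obtain b where b: "b \<in> M" "Poly_Mapping.lookup b \<le> Poly_Mapping.lookup a"
        using monomial_mem_Idl_iff[OF M] a keys_N by blast
      then have "b = m"
        using antichain m a(2) by (meson order_trans)
      then show "m \<in> N"
        using a b by (metis antisym poly_mapping_eqI)
    qed
    \<comment> \<open>Were the inclusion strict, \<open>M\<close> would be a proper subset of
      \<open>N\<close> generating the same ideal.\<close>
    then show "N = M"
      using minimal[of M] by blast
  }
  \<comment> \<open>An omitted generator would be divisible by one that was kept, against the
    antichain property.\<close>
  have "Idl\<^bsub>mpoly_ring n\<^esub> (monomial ` N) \<noteq> (Idl\<^bsub>mpoly_ring n\<^esub> (monomial ` M) :: 'k mpoly set)"
    if sub: "N \<subset> M" for N
  proof
    assume eq: "Idl\<^bsub>mpoly_ring n\<^esub> (monomial ` N) = (Idl\<^bsub>mpoly_ring n\<^esub> (monomial ` M) :: 'k mpoly set)"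
    obtain m where m: "m \<in> M" "m \<notin> N"
      using sub by blast
    have keys_N: "\<forall>a\<in>N. Poly_Mapping.keys a \<subseteq> {1..n}"
      using sub M by blast
    have "(monomial m :: 'k mpoly) \<in> Idl\<^bsub>mpoly_ring n\<^esub> (monomial ` N)"
      using self[OF m(1) M] eq by simp
    then obtain a where "a \<in> N" "Poly_Mapping.lookup a \<le> Poly_Mapping.lookup m"
      using monomial_mem_Idl_iff[OF keys_N] m(1) M by blast
    then show False
      using antichain m sub by blast
  qed
  then show "N = M \<Longrightarrow> min_monomial_gens n (Idl\<^bsub>mpoly_ring n\<^esub> (monomial ` M) :: 'k mpoly set) N"
    using M by (auto simp: min_monomial_gens_def)
qed

section \<open>Squarefree monomials as finite sets of variables\<close>

definition squarefree_exponent :: "nat set \<Rightarrow> (nat \<Rightarrow>\<^sub>0 nat)" where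
  "squarefree_exponent \<sigma> = (\<Sum>s\<in>\<sigma>. Poly_Mapping.single s 1)"

lemma lookup_squarefree_exponent:
  "finite \<sigma> \<Longrightarrow> Poly_Mapping.lookup (squarefree_exponent \<sigma>) s = of_bool (s \<in> \<sigma>)"
  by (simp add: squarefree_exponent_def lookup_sum lookup_single when_def)

lemma keys_squarefree_exponent [simp]:
  "finite \<sigma> \<Longrightarrow> Poly_Mapping.keys (squarefree_exponent \<sigma>) = \<sigma>"
  by (auto simp: in_keys_iff lookup_squarefree_exponent)

lemma squarefree_exponent_le_iff:
  assumes "finite \<sigma>" "finite \<tau>"
  shows "Poly_Mapping.lookup (squarefree_exponent \<sigma>) \<le> Poly_Mapping.lookup (squarefree_exponent \<tau>)
    \<longleftrightarrow> \<sigma> \<subseteq> \<tau>"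
  using assms by (auto simp: le_fun_def lookup_squarefree_exponent of_bool_def split: if_splits)

text \<open>The support recovers the set. This lets cardinalities of families pass between sets and
  exponent vectors.\<close>

lemma inj_on_squarefree_exponent: "inj_on squarefree_exponent {\<sigma>. finite \<sigma>}"
  by (rule inj_onI) (metis keys_squarefree_exponent mem_Collect_eq)

lemma prod_var_eq:
  "(\<Prod>s\<in>\<sigma>. var s) = (monomial (squarefree_exponent \<sigma>) :: 'k::field mpoly)"
proof (induction \<sigma> rule: infinite_finite_induct)
  case (insert s \<sigma>)
  then show ?case
    by (simp add: squarefree_exponent_def var_def monomial_mult)
\<comment> \<open>In the infinite and empty cases the sum is 0, the product is 1, and
  \<open>monomial 0\<close> is 1.\<close>
qed (simp_all add: squarefree_exponent_def monomial_def)

text \<open>At each variable, the maximum of the 0/1 exponents is 1 exactly when some member of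
  \<open>F\<close> contains it.\<close>

lemma monomial_lcm_squarefree_exponent:
  assumes "finite F" "F \<noteq> {}" "\<forall>\<sigma>\<in>F. finite \<sigma>"
  shows "monomial_lcm (squarefree_exponent ` F) = squarefree_exponent (\<Union>F)"
proof (rule poly_mapping_eqI)
  fix s
  have "Max ((\<lambda>\<sigma>. of_bool (s \<in> \<sigma>) :: nat) ` F) = of_bool (s \<in> \<Union>F)"
    using assms by (intro Max_eqI) (auto simp: of_bool_def)
  moreover have "(\<lambda>\<sigma>. Poly_Mapping.lookup (squarefree_exponent \<sigma>) s) ` F = (\<lambda>\<sigma>. of_bool (s \<in> \<sigma>)) ` F"
    using assms by (intro image_cong) (auto simp: lookup_squarefree_exponent)
  ultimately show "Poly_Mapping.lookup (monomial_lcm (squarefree_exponent ` F)) s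
      = Poly_Mapping.lookup (squarefree_exponent (\<Union>F)) s"
    using assms by (simp add: lookup_monomial_lcm image_image lookup_squarefree_exponent)
qed

section \<open>Failure ideals and their lcm-ideals\<close>

lemma failure_ideal_eq:
  "(failure_ideal j n :: 'k::field mpoly set) =
    Idl\<^bsub>mpoly_ring n\<^esub> (monomial ` squarefree_exponent ` {\<sigma>. \<sigma> \<subseteq> {1..n} \<and> card \<sigma> = j})"
  by (simp add: failure_ideal_def prod_var_eq setcompr_eq_image image_image)

text \<open>Finite sets of equal size are comparable only when equal, so the generators form an
  antichain.\<close>

lemma min_monomial_gens_failure_ideal_iff:
  "min_monomial_gens n (failure_ideal k n :: 'k::field mpoly set) M \<longleftrightarrow>
    M = squarefree_exponent ` {\<sigma>. \<sigma> \<subseteq> {1..n} \<and> card \<sigma> = k}"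
  unfolding failure_ideal_eq
proof (rule min_monomial_gens_antichain_iff)
  show "\<forall>a\<in>squarefree_exponent ` {\<sigma>. \<sigma> \<subseteq> {1..n} \<and> card \<sigma> = k}. Poly_Mapping.keys a \<subseteq> {1..n}"
    using keys_squarefree_exponent[OF finite_subset[OF _ finite_atLeastAtMost]] by blast
next
  fix a b
  assume "a \<in> squarefree_exponent ` {\<sigma>. \<sigma> \<subseteq> {1..n} \<and> card \<sigma> = k}"
    and "b \<in> squarefree_exponent ` {\<sigma>. \<sigma> \<subseteq> {1..n} \<and> card \<sigma> = k}"
    and le: "Poly_Mapping.lookup a \<le> Poly_Mapping.lookup b"
  then obtain \<sigma> \<tau> where eqs: "a = squarefree_exponent \<sigma>" "b = squarefree_exponent \<tau>"
      "card \<sigma> = k" "card \<tau> = k" and "\<sigma> \<subseteq> {1..n}" "\<tau> \<subseteq> {1..n}"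
    by blast
  then have fin: "finite \<sigma>" "finite \<tau>"
    using finite_subset[OF _ finite_atLeastAtMost] by blast+
  have "\<sigma> \<subseteq> \<tau>"
    using le eqs fin squarefree_exponent_le_iff by blast
  then show "a = b"
    using eqs fin card_subset_eq[of \<tau> \<sigma>] by simp
qed

lemma lcm_ideal_failure_ideal_eq:
  assumes "0 < l"
  shows "(lcm_ideal n l (failure_ideal k n) :: 'k::field mpoly set) =
    Idl\<^bsub>mpoly_ring n\<^esub> (monomial ` squarefree_exponent `
      {\<Union>F | F. F \<subseteq> {\<sigma>. \<sigma> \<subseteq> {1..n} \<and> card \<sigma> = k} \<and> card F = l})"
proof -
  let ?K = "{\<sigma>. \<sigma> \<subseteq> {1..n} \<and> card \<sigma> = k}"
  have fin: "finite \<sigma>" if "\<sigma> \<in> ?K" for \<sigma>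
    using finite_subset[OF _ finite_atLeastAtMost, of \<sigma> 1 n] that by simp
  have lcm_F: "monomial_lcm (squarefree_exponent ` F) = squarefree_exponent (\<Union>F)"
    and card_F: "card (squarefree_exponent ` F) = card F"
    if "F \<subseteq> ?K" "card F = l" for F
  proof -
    \<comment> \<open>Positive cardinality excludes the infinite family as well as the empty one,
      since infinite sets have \<open>card\<close> 0.\<close>
    have "finite F" "F \<noteq> {}"
      using that(2) assms by (auto simp: card_gt_0_iff)
    moreover have fin_F: "\<forall>\<sigma>\<in>F. finite \<sigma>"
      using that(1) fin by blast
    ultimately show "monomial_lcm (squarefree_exponent ` F) = squarefree_exponent (\<Union>F)"
      by (rule monomial_lcm_squarefree_exponent)
    show "card (squarefree_exponent ` F) = card F"
      using fin_F by (intro card_image inj_on_subset[OF inj_on_squarefree_exponent]) auto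
  qed
  have "{monomial (monomial_lcm \<sigma>) | \<sigma>. \<sigma> \<subseteq> squarefree_exponent ` ?K \<and> card \<sigma> = l} =
      (monomial ` squarefree_exponent ` {\<Union>F | F. F \<subseteq> ?K \<and> card F = l} :: 'k mpoly set)"
    (is "?L = ?R")
  proof (intro subset_antisym subsetI)
    fix p assume "p \<in> ?L"
    then obtain A where A: "p = monomial (monomial_lcm A)" "A \<subseteq> squarefree_exponent ` ?K" "card A = l"
      by blast
    \<comment> \<open>A preimage family on which the map is injective inherits the cardinality of
      \<open>A\<close>.\<close>
    obtain F where F: "F \<subseteq> ?K" "inj_on squarefree_exponent F" "A = squarefree_exponent ` F"
      using A(2) unfolding subset_image_inj by blast
    then have "card F = l"
      using A(3) card_image[OF F(2)] by simp
    then show "p \<in> ?R"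
      using F A(1) lcm_F[OF F(1)] by auto
  next
    fix p assume "p \<in> ?R"
    then obtain F where F: "p = monomial (squarefree_exponent (\<Union>F))" "F \<subseteq> ?K" "card F = l"
      by blast
    then show "p \<in> ?L"
      using lcm_F card_F by (auto intro!: exI[of _ "squarefree_exponent ` F"])
  qed
  then show ?thesis
    by (simp add: lcm_ideal_def min_monomial_gens_failure_ideal_iff)
qed

section \<open>Counting \<open>k\<close>-subsets and comparing the two ideals\<close>

lemma card_family_le_choose_Union:
  assumes "finite (\<Union>F)" "\<forall>\<sigma>\<in>F. card \<sigma> = k"
  shows "card F \<le> card (\<Union>F) choose k"
proof -
  have "card F \<le> card {\<sigma>. \<sigma> \<subseteq> \<Union>F \<and> card \<sigma> = k}"
    using assms by (intro card_mono) auto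
  then show ?thesis
    using n_subsets[OF assms(1)] by simp
qed

theorem theorem2p1:
  fixes k n j l :: nat
  assumes "1 \<le> k" and "k < n"
    and "k < j" and "j \<le> n"
    and "(j - 1) choose k < l" and "l \<le> j choose k"
  shows "lcm_ideal n l (failure_ideal k n) = (failure_ideal j n :: 'k::field mpoly set)
    \<and> (failure_ideal j n :: 'k mpoly set) =
        Idl\<^bsub>mpoly_ring n\<^esub> {\<Prod>s\<in>\<sigma>. var s | \<sigma>. \<sigma> \<subseteq> {1..n} \<and> card \<sigma> = j}"
proof
  let ?K = "{\<sigma>. \<sigma> \<subseteq> {1..n} \<and> card \<sigma> = k}"
  let ?U = "{\<Union>F | F. F \<subseteq> ?K \<and> card F = l}"
  let ?T = "{\<sigma>. \<sigma> \<subseteq> {1..n} \<and> card \<sigma> = j}"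
  have fin: "finite \<sigma>" if "\<sigma> \<subseteq> {1..n}" for \<sigma>
    using finite_subset[OF _ finite_atLeastAtMost, of \<sigma> 1 n] that by simp
  have U_sub: "\<sigma> \<subseteq> {1..n}" if "\<sigma> \<in> ?U" for \<sigma>
    using that by blast
  have keys_U: "\<forall>a\<in>squarefree_exponent ` ?U. Poly_Mapping.keys a \<subseteq> {1..n}"
    using U_sub fin by (metis (no_types, lifting) imageE keys_squarefree_exponent)
  have keys_T: "\<forall>a\<in>squarefree_exponent ` ?T. Poly_Mapping.keys a \<subseteq> {1..n}"
    using fin by auto
  have T_below: "\<exists>T\<in>?T. T \<subseteq> U" if U: "U \<in> ?U" for U
  proof -
    obtain F where F: "U = \<Union>F" "F \<subseteq> ?K" "card F = l"
      using U by blast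
    then have "l \<le> card U choose k"
      using card_family_le_choose_Union[of F k] fin[OF U_sub[OF U]] by auto
    \<comment> \<open>If \<open>U\<close> had at most \<open>j - 1\<close> elements, monotonicity of
      the binomial would give \<open>l \<le> (j - 1) choose k\<close>, against the strict lower
      bound on \<open>l\<close>.\<close>
    then have "j \<le> card U"
      using assms(5) binomial_right_mono[of "card U" "j - 1" k] by linarith
    then obtain T where "T \<subseteq> U" "card T = j"
      using obtain_subset_with_card_n by metis
    then show ?thesis
      using U_sub[OF U] by blast
  qed
  have U_below: "\<exists>U\<in>?U. U \<subseteq> T" if T: "T \<in> ?T" for T
  proof -
    \<comment> \<open>\<open>T\<close> has exactly \<open>j choose k\<close> subsets of size
      \<open>k\<close>, so the upper bound on \<open>l\<close> allows choosing \<open>l\<close> of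
      them; their union stays inside \<open>T\<close>.\<close>
    have "l \<le> card {\<sigma>. \<sigma> \<subseteq> T \<and> card \<sigma> = k}"
      using T fin assms(6) by (simp add: n_subsets)
    then obtain F where F: "F \<subseteq> {\<sigma>. \<sigma> \<subseteq> T \<and> card \<sigma> = k}" "card F = l"
      by (rule obtain_subset_with_card_n) blast
    moreover from F(1) T have "F \<subseteq> ?K"
      by fastforce
    ultimately have "\<Union>F \<in> ?U" "\<Union>F \<subseteq> T"
      by blast+
    then show ?thesis
      by blast
  qed
  have "Idl\<^bsub>mpoly_ring n\<^esub> (monomial ` squarefree_exponent ` ?U) =
      (Idl\<^bsub>mpoly_ring n\<^esub> (monomial ` squarefree_exponent ` ?T) :: 'k mpoly set)"
  \<comment> \<open>A subset gives a divisor: \<open>T_below\<close> puts the ideal of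
    \<open>?U\<close> inside that of \<open>?T\<close>, and \<open>U_below\<close> gives the
    converse.\<close>
  proof (intro subset_antisym Idl_monomial_mono keys_U keys_T ballI)
    fix a assume "a \<in> squarefree_exponent ` ?U"
    then obtain U where U: "U \<in> ?U" "a = squarefree_exponent U"
      by blast
    with T_below obtain T where T: "T \<in> ?T" "T \<subseteq> U"
      by blast
    have "finite U" "finite T"
      using fin U_sub[OF U(1)] T(1) by auto
    then have "Poly_Mapping.lookup (squarefree_exponent T) \<le> Poly_Mapping.lookup a"
      using U(2) T(2) by (simp add: squarefree_exponent_le_iff)
    then show "\<exists>b\<in>squarefree_exponent ` ?T. Poly_Mapping.lookup b \<le> Poly_Mapping.lookup a"
      using T(1) by blast
  next
    fix a assume "a \<in> squarefree_exponent ` ?T"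
    then obtain T where T: "T \<in> ?T" "a = squarefree_exponent T"
      by blast
    with U_below obtain U where U: "U \<in> ?U" "U \<subseteq> T"
      by blast
    have "finite U" "finite T"
      using fin U_sub[OF U(1)] T(1) by auto
    then have "Poly_Mapping.lookup (squarefree_exponent U) \<le> Poly_Mapping.lookup a"
      using T(2) U(2) by (simp add: squarefree_exponent_le_iff)
    then show "\<exists>b\<in>squarefree_exponent ` ?U. Poly_Mapping.lookup b \<le> Poly_Mapping.lookup a"
      using U(1) by blast
  qed
  \<comment> \<open>Positivity comes from \<open>l\<close> strictly exceeding a natural
    number.\<close>
  moreover have "0 < l"
    using assms(5) by simp
  ultimately show "lcm_ideal n l (failure_ideal k n) = (failure_ideal j n :: 'k mpoly set)"
    by (subst lcm_ideal_failure_ideal_eq) (simp_all add: failure_ideal_eq)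
qed (simp add: failure_ideal_def)

end
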